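(* For every integer $n\ge0$, \[ \sigma_3^{*}(n)=2n\sigma^{*}(n)-4\sum_{j=0}^{n}\sigma^{*}(j)\sigma^{*}(n-j). \]
   Context: For $n\ge1$ and $s\ge1$, $\sigma^{*}_{s}(n)=-\sum_{d\mid n}(-1)^{d}d^{s}$, and $\sigma^{*}(n)=\sigma^{*}_1(n)$. By convention $\sigma^{*}(0)=\frac18$ and $\sigma^{*}_3(0)=-\frac1{16}$. *)

theory Defs
  imports Complex_Main
begin

(* The values at n = 0 are conventions; they are fixed only for s = 1 and s = 3. *)
definition sigma_star :: "nat \<Rightarrow> nat \<Rightarrow> real" where
  "sigma_star s n =
     (if n = 0 then (if s = 1 then 1 / 8 else if s = 3 then - (1 / 16) else undefined)
      else - (\<Sum>d | d dvd n. (- 1) ^ d * real d ^ s))"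

end

theory Submission
  imports Defs
begin

text \<open>
  For positive \<open>n\<close>, the terms with \<open>0 < j < n\<close> form the sum of \<open>(-1)^(a+b) a b\<close> over all positive
  solutions of \<open>a x + b y = n\<close>. Up to the factor \<open>-4\<close> this summand is \<open>F (a - b) - F (a + b)\<close> for the
  even function \<open>F k = (-1)^k k^2\<close>, so Liouville's identity turns the sum into a divisor sum.
  Liouville's identity itself follows from Euclidean-type substitutions such as
  \<open>(a, b, x, y) \<mapsto> (a - b, b, x, x + y)\<close>, which preserve the equation, so that after cancellation only
  the diagonal solutions \<open>a = b\<close> and \<open>x = y\<close> contribute.
\<close>

definition two_term_reps :: "nat \<Rightarrow> (nat \<times> nat \<times> nat \<times> nat) set" where
  "two_term_reps n =
     {(a, b, x, y). 0 < a \<and> 0 < b \<and> 0 < x \<and> 0 < y \<and> a * x + b * y = n}"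

lemma finite_two_term_reps [simp]: "finite (two_term_reps n)"
proof (rule finite_subset)
  have le: "a \<le> a * x + b * y" "x \<le> a * x + b * y" "b \<le> a * x + b * y" "y \<le> a * x + b * y"
    if "0 < a" "0 < b" "0 < x" "0 < y" for a b x y :: nat
    using that by (simp_all add: trans_le_add1 trans_le_add2)
  show "two_term_reps n \<subseteq> {..n} \<times> {..n} \<times> {..n} \<times> {..n}"
    unfolding two_term_reps_def using le by auto
qed auto

text \<open>The keys \<open>u\<close> and \<open>v\<close> stay abstract so that the same split
  serves to compare the coefficients \<open>a\<close>, \<open>b\<close> and the multipliers
  \<open>x\<close>, \<open>y\<close>.\<close>

lemma sum_two_term_reps_trichotomy:
  fixes f :: "nat \<times> nat \<times> nat \<times> nat \<Rightarrow> 'a::comm_monoid_add" and u v :: "_ \<Rightarrow> nat"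
  shows "sum f (two_term_reps n) =
    sum f {q \<in> two_term_reps n. u q < v q} + sum f {q \<in> two_term_reps n. u q = v q} +
    sum f {q \<in> two_term_reps n. v q < u q}"
proof -
  let ?L = "{q \<in> two_term_reps n. u q < v q}" and ?E = "{q \<in> two_term_reps n. u q = v q}"
    and ?G = "{q \<in> two_term_reps n. v q < u q}"
  have "two_term_reps n = ?L \<union> ?E \<union> ?G"
    by auto
  then have "sum f (two_term_reps n) = sum f (?L \<union> ?E \<union> ?G)"
    by simp
  also have "\<dots> = sum f (?L \<union> ?E) + sum f ?G"
    by (rule sum.union_disjoint) auto
  also have "sum f (?L \<union> ?E) = sum f ?L + sum f ?E"
    by (rule sum.union_disjoint) auto
  finally show ?thesis .
qed

text \<open>With \<open>a = b = d\<close> the equation reads \<open>d * (x + y) = n\<close>: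
  \<open>d\<close> divides \<open>n\<close>, and \<open>n div d - 1\<close> counts the choices of
  \<open>x\<close>.\<close>

lemma sum_two_term_reps_diagonal_coeffs:
  fixes G :: "nat \<Rightarrow> 'a::comm_ring_1"
  assumes "0 < n"
  shows "(\<Sum>(a, b, x, y) \<in> {(a, b, x, y) \<in> two_term_reps n. a = b}. G a) =
    (\<Sum>d | d dvd n. of_nat (n div d - 1) * G d)"
proof -
  have "(\<Sum>(a, b, x, y) \<in> {(a, b, x, y) \<in> two_term_reps n. a = b}. G a) =
    (\<Sum>(d, l) \<in> Sigma {d. d dvd n} (\<lambda>d. {1..<n div d}). G d)"
    by (rule sum.reindex_bij_witness[where j = "\<lambda>(a, b, x, y). (a, x)"
          and i = "\<lambda>(d, l). (d, d, l, n div d - l)"])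
      (use assms in \<open>auto simp: two_term_reps_def simp flip: distrib_left\<close>)
  also have "\<dots> = (\<Sum>d | d dvd n. \<Sum>l \<in> {1..<n div d}. G d)"
    using assms by (subst sum.Sigma) auto
  finally show ?thesis
    by simp
qed

text \<open>With \<open>x = y\<close> the equation reads \<open>(a + b) * x = n\<close>, so
  \<open>d = a + b\<close> divides \<open>n\<close> and \<open>l = a\<close> runs through the ways
  to split \<open>d\<close> into two positive parts.\<close>

lemma sum_two_term_reps_diagonal_multipliers:
  fixes G :: "nat \<Rightarrow> nat \<Rightarrow> 'a::comm_ring_1"
  assumes "0 < n"
  shows "(\<Sum>(a, b, x, y) \<in> {(a, b, x, y) \<in> two_term_reps n. x = y}. G a b) =
    (\<Sum>d | d dvd n. \<Sum>l \<in> {1..<d}. G l (d - l))"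
proof -
  have "(\<Sum>(a, b, x, y) \<in> {(a, b, x, y) \<in> two_term_reps n. x = y}. G a b) =
    (\<Sum>(d, l) \<in> Sigma {d. d dvd n} (\<lambda>d. {1..<d}). G l (d - l))"
    by (rule sum.reindex_bij_witness[where j = "\<lambda>(a, b, x, y). (a + b, a)"
          and i = "\<lambda>(d, l). (l, d - l, n div d, n div d)"])
      (use assms in \<open>auto simp: two_term_reps_def simp flip: distrib_right intro!: Nat.gr0I\<close>)
  also have "\<dots> = (\<Sum>d | d dvd n. \<Sum>l \<in> {1..<d}. G l (d - l))"
    using assms by (subst sum.Sigma) (auto intro: finite_subset)
  finally show ?thesis .
qed

theorem liouville_identity:
  fixes F :: "int \<Rightarrow> 'a::comm_ring_1"
  assumes even: "\<And>k. F (- k) = F k" and "0 < n"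
  shows "(\<Sum>(a, b, x, y) \<in> two_term_reps n. F (int a - int b) - F (int a + int b)) =
    (\<Sum>d | d dvd n. of_nat (n div d - 1) * (F 0 + 2 * F (int d)) - of_nat (d - 1) * F (int d)
       - 2 * (\<Sum>l \<in> {1..<d}. F (int l)))"
proof -
  let ?Q = "two_term_reps n"
  let ?S = "\<lambda>P f. \<Sum>(a, b, x, y) \<in> {(a, b, x, y) \<in> ?Q. P a b x y}. (f a b :: 'a)"
  have split_coeffs: "(\<Sum>(a, b, x, y) \<in> ?Q. f a b) =
      ?S (\<lambda>a b x y. a < b) f + ?S (\<lambda>a b x y. a = b) f + ?S (\<lambda>a b x y. b < a) f" for f
    using sum_two_term_reps_trichotomy[of "\<lambda>(a, b, x, y). f a b" n
        "\<lambda>(a, b, x, y). a" "\<lambda>(a, b, x, y). b"]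
    by (simp add: case_prod_unfold)
  have split_mults: "(\<Sum>(a, b, x, y) \<in> ?Q. f a b) =
      ?S (\<lambda>a b x y. x < y) f + ?S (\<lambda>a b x y. x = y) f + ?S (\<lambda>a b x y. y < x) f" for f
    using sum_two_term_reps_trichotomy[of "\<lambda>(a, b, x, y). f a b" n
        "\<lambda>(a, b, x, y). x" "\<lambda>(a, b, x, y). y"]
    by (simp add: case_prod_unfold)
  have even_diff: "F (int a - int b) = F (int b - int a)" for a b
    using even[of "int b - int a"] by simp
  \<comment> \<open>Exchanging the two products flips the sign of \<open>a - b\<close>; here
    evenness of \<open>F\<close> enters.\<close>
  have diff_sym: "?S (\<lambda>a b x y. a < b) (\<lambda>a b. F (int a - int b)) =
      ?S (\<lambda>a b x y. b < a) (\<lambda>a b. F (int a - int b))"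
    by (rule sum.reindex_bij_witness[where j = "\<lambda>(a, b, x, y). (b, a, y, x)"
          and i = "\<lambda>(a, b, x, y). (b, a, y, x)"])
      (auto simp: two_term_reps_def add.commute even_diff)
  \<comment> \<open>Since \<open>a x + b y = (a - b) x + b (x + y)\<close>, the argument
    \<open>a - b\<close> becomes the first coefficient. \<open>less_natE\<close> writes the larger
    number as a sum, which removes truncated subtraction.\<close>
  have diff_shift: "?S (\<lambda>a b x y. b < a) (\<lambda>a b. F (int a - int b)) =
      ?S (\<lambda>a b x y. x < y) (\<lambda>a b. F (int a))"
    by (rule sum.reindex_bij_witness[where j = "\<lambda>(a, b, x, y). (a - b, b, x, x + y)"
          and i = "\<lambda>(a, b, x, y). (a + b, b, x, y - x)"])
      (auto simp: two_term_reps_def algebra_simps elim!: less_natE)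
  have sum_sym: "?S (\<lambda>a b x y. x < y) (\<lambda>a b. F (int a + int b)) =
      ?S (\<lambda>a b x y. y < x) (\<lambda>a b. F (int a + int b))"
    by (rule sum.reindex_bij_witness[where j = "\<lambda>(a, b, x, y). (b, a, y, x)"
          and i = "\<lambda>(a, b, x, y). (b, a, y, x)"])
      (auto simp: two_term_reps_def algebra_simps)
  \<comment> \<open>Here \<open>a x + b y = (a + b) y + a (x - y)\<close> makes \<open>a + b\<close>
    the first coefficient.\<close>
  have sum_shift: "?S (\<lambda>a b x y. y < x) (\<lambda>a b. F (int a + int b)) =
      ?S (\<lambda>a b x y. b < a) (\<lambda>a b. F (int a))"
    by (rule sum.reindex_bij_witness[where j = "\<lambda>(a, b, x, y). (a + b, a, y, x - y)"
          and i = "\<lambda>(a, b, x, y). (b, a - b, x + y, x)"])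
      (auto simp: two_term_reps_def algebra_simps elim!: less_natE)
  \<comment> \<open>The rewriting \<open>a x + b y = a (x - y) + (a + b) y\<close> leaves the first
    coefficient unchanged.\<close>
  have shift: "?S (\<lambda>a b x y. y < x) (\<lambda>a b. F (int a)) = ?S (\<lambda>a b x y. a < b) (\<lambda>a b. F (int a))"
    by (rule sum.reindex_bij_witness[where j = "\<lambda>(a, b, x, y). (a, a + b, x - y, y)"
          and i = "\<lambda>(a, b, x, y). (a, b - a, x + y, y)"])
      (auto simp: two_term_reps_def algebra_simps elim!: less_natE)
  \<comment> \<open>Both splits of the full sum of \<open>F (int a)\<close> agree, and
    \<open>shift\<close> cancels one off-diagonal part from each.\<close>
  have cancel: "?S (\<lambda>a b x y. x < y) (\<lambda>a b. F (int a)) - ?S (\<lambda>a b x y. b < a) (\<lambda>a b. F (int a)) =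
      ?S (\<lambda>a b x y. a = b) (\<lambda>a b. F (int a)) - ?S (\<lambda>a b x y. x = y) (\<lambda>a b. F (int a))"
    using split_coeffs[of "\<lambda>a b. F (int a)"] split_mults[of "\<lambda>a b. F (int a)"] shift
    by (simp add: algebra_simps)
  have diff_diag: "?S (\<lambda>a b x y. a = b) (\<lambda>a b. F (int a - int b)) =
      (\<Sum>d | d dvd n. of_nat (n div d - 1) * F 0)"
    unfolding sum_two_term_reps_diagonal_coeffs[OF \<open>0 < n\<close>, of "\<lambda>_. F 0", symmetric]
    by (rule sum.cong) auto
  have sum_diag: "?S (\<lambda>a b x y. x = y) (\<lambda>a b. F (int a + int b)) =
      (\<Sum>d | d dvd n. of_nat (d - 1) * F (int d))"
    using sum_two_term_reps_diagonal_multipliers[OF \<open>0 < n\<close>, of "\<lambda>a b. F (int a + int b)"]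
    by simp
  have "(\<Sum>(a, b, x, y) \<in> ?Q. F (int a - int b) - F (int a + int b)) =
      (\<Sum>(a, b, x, y) \<in> ?Q. F (int a - int b)) - (\<Sum>(a, b, x, y) \<in> ?Q. F (int a + int b))"
    by (simp add: case_prod_unfold sum_subtractf)
  also have "\<dots> = (\<Sum>d | d dvd n. of_nat (n div d - 1) * F 0)
      - (\<Sum>d | d dvd n. of_nat (d - 1) * F (int d))
      + 2 * (?S (\<lambda>a b x y. x < y) (\<lambda>a b. F (int a)) - ?S (\<lambda>a b x y. b < a) (\<lambda>a b. F (int a)))"
    unfolding split_coeffs[of "\<lambda>a b. F (int a - int b)"] split_mults[of "\<lambda>a b. F (int a + int b)"]
      diff_sym diff_shift sum_sym sum_shift diff_diag sum_diag
    by (simp add: algebra_simps)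
  also have "\<dots> = (\<Sum>d | d dvd n. of_nat (n div d - 1) * F 0)
      - (\<Sum>d | d dvd n. of_nat (d - 1) * F (int d))
      + 2 * ((\<Sum>d | d dvd n. of_nat (n div d - 1) * F (int d))
             - (\<Sum>d | d dvd n. \<Sum>l \<in> {1..<d}. F (int l)))"
    unfolding cancel
      sum_two_term_reps_diagonal_coeffs[OF \<open>0 < n\<close>, of "\<lambda>a. F (int a)"]
      sum_two_term_reps_diagonal_multipliers[OF \<open>0 < n\<close>, of "\<lambda>a b. F (int a)"] ..
  also have "\<dots> = (\<Sum>d | d dvd n. of_nat (n div d - 1) * (F 0 + 2 * F (int d))
      - of_nat (d - 1) * F (int d) - 2 * (\<Sum>l \<in> {1..<d}. F (int l)))"
    by (simp add: sum.distrib sum_subtractf sum_distrib_left distrib_left right_diff_distrib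
        mult.left_commute)
  finally show ?thesis .
qed

text \<open>Up to sign, alternating sums of squares are triangular numbers. This evaluates the inner
  sum of Liouville's identity for \<open>F k = (-1)^k k^2\<close>.\<close>

lemma alternating_sum_squares:
  fixes d :: nat
  assumes "0 < d"
  shows "2 * (\<Sum>l \<in> {1..<d}. (- 1) ^ l * real l ^ 2) = - ((- 1) ^ d * real d * (real d - 1))"
  using assms
  by (induction d rule: nat_induct_non_zero) (simp_all add: algebra_simps power2_eq_square)

lemma sigma_star_pos:
  "0 < n \<Longrightarrow> sigma_star s n = - (\<Sum>d | d dvd n. (- 1) ^ d * real d ^ s)"
  by (simp add: sigma_star_def)

text \<open>A divisor \<open>a\<close> of \<open>j\<close> and a divisor \<open>b\<close> of
  \<open>n - j\<close>, recorded with their cofactors \<open>x\<close> and \<open>y\<close>, form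
  one solution of \<open>a x + b y = n\<close>; the two minus signs cancel.\<close>

lemma sum_sigma_star_convolution:
  "(\<Sum>j \<in> {1..<n}. sigma_star 1 j * sigma_star 1 (n - j)) =
    (\<Sum>(a, b, x, y) \<in> two_term_reps n. (- 1) ^ (a + b) * real a * real b)"
proof -
  have "(\<Sum>j \<in> {1..<n}. sigma_star 1 j * sigma_star 1 (n - j)) =
      (\<Sum>j \<in> {1..<n}. \<Sum>(a, b) \<in> {a. a dvd j} \<times> {b. b dvd n - j}.
         (- 1) ^ (a + b) * real a * real b)"
    by (intro sum.cong refl)
      (simp add: sigma_star_pos sum_product sum.cartesian_product power_add mult_ac)
  also have "\<dots> = (\<Sum>(j, a, b) \<in> Sigma {1..<n} (\<lambda>j. {a. a dvd j} \<times> {b. b dvd n - j}).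
      (- 1) ^ (a + b) * real a * real b)"
    by (subst sum.Sigma) auto
  also have "\<dots> = (\<Sum>(a, b, x, y) \<in> two_term_reps n. (- 1) ^ (a + b) * real a * real b)"
    by (rule sum.reindex_bij_witness[where j = "\<lambda>(j, a, b). (a, b, j div a, (n - j) div b)"
          and i = "\<lambda>(a, b, x, y). (a * x, a, b)"])
      (auto simp: two_term_reps_def dvd_div_eq_0_iff intro!: Nat.gr0I)
  finally show ?thesis .
qed

theorem theorem3p2:
  fixes n :: nat
  shows "sigma_star 3 n =
    2 * real n * sigma_star 1 n - 4 * (\<Sum>j = 0..n. sigma_star 1 j * sigma_star 1 (n - j))"
proof (cases "n = 0")
  case True
  \<comment> \<open>The conventions match: \<open>- 1 / 16 = - 4 * (1 / 8)^2\<close>.\<close>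
  then show ?thesis
    by (simp add: sigma_star_def)
next
  case False
  then have n: "0 < n"
    by simp
  \<comment> \<open>The sign is given by parity because \<open>k\<close> may be negative. As
    \<open>a - b\<close> and \<open>a + b\<close> have equal parity,
    \<open>(a - b)^2 - (a + b)^2 = - 4 a b\<close> yields the summand.\<close>
  define F :: "int \<Rightarrow> real" where "F k = (if even k then 1 else - 1) * of_int k ^ 2" for k
  have F_int: "F (int d) = (- 1) ^ d * real d ^ 2" for d
    by (simp add: F_def)
  have F_diff: "F (int a - int b) - F (int a + int b) = - 4 * ((- 1) ^ (a + b) * real a * real b)"
    for a b
    by (auto simp: F_def power2_eq_square algebra_simps)
  have "- 4 * (\<Sum>j \<in> {1..<n}. sigma_star 1 j * sigma_star 1 (n - j)) =
      (\<Sum>(a, b, x, y) \<in> two_term_reps n. F (int a - int b) - F (int a + int b))"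
    unfolding sum_sigma_star_convolution F_diff by (simp add: sum_distrib_left case_prod_unfold)
  also have "\<dots> = (\<Sum>d | d dvd n. real (n div d - 1) * (F 0 + 2 * F (int d))
      - real (d - 1) * F (int d) - 2 * (\<Sum>l \<in> {1..<d}. F (int l)))"
    by (rule liouville_identity) (simp_all add: F_def n)
  also have "\<dots> = (\<Sum>d | d dvd n. 2 * real n * ((- 1) ^ d * real d) - (- 1) ^ d * real d ^ 3
      - (- 1) ^ d * real d)"
  \<comment> \<open>With \<open>n = d * k\<close> and \<open>F 0 = 0\<close>, the multiples of
    \<open>d^2\<close> that do not involve \<open>k\<close> add up to
    \<open>- 2 + 1 + 1 = 0\<close>, and \<open>2 k d^2 = 2 n d\<close>.\<close>
  proof (rule sum.cong)
    fix d assume "d \<in> {d. d dvd n}"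
    then obtain k where k: "n = d * k" and pos: "0 < d" "0 < k"
      using n by auto
    then show "real (n div d - 1) * (F 0 + 2 * F (int d)) - real (d - 1) * F (int d)
        - 2 * (\<Sum>l \<in> {1..<d}. F (int l)) =
      2 * real n * ((- 1) ^ d * real d) - (- 1) ^ d * real d ^ 3 - (- 1) ^ d * real d"
      unfolding F_int alternating_sum_squares[OF pos(1)]
      by (simp add: F_def of_nat_diff algebra_simps power2_eq_square power3_eq_cube)
  qed simp
  also have "\<dots> = - 2 * real n * sigma_star 1 n + sigma_star 3 n + sigma_star 1 n"
    using n by (simp add: sigma_star_pos sum_subtractf sum_negf flip: sum_distrib_left)
  finally have inner: "- 4 * (\<Sum>j \<in> {1..<n}. sigma_star 1 j * sigma_star 1 (n - j)) =
      - 2 * real n * sigma_star 1 n + sigma_star 3 n + sigma_star 1 n" .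
  \<comment> \<open>The end terms \<open>j = 0\<close> and \<open>j = n\<close> together contribute
    \<open>- 4 * 2 * (1 / 8) * sigma_star 1 n\<close>, which absorbs the extra
    \<open>sigma_star 1 n\<close> in \<open>inner\<close>.\<close>
  have "{0..n} = insert 0 (insert n {1..<n})"
    using n by auto
  then have "(\<Sum>j = 0..n. sigma_star 1 j * sigma_star 1 (n - j)) =
      2 * (sigma_star 1 0 * sigma_star 1 n) +
      (\<Sum>j \<in> {1..<n}. sigma_star 1 j * sigma_star 1 (n - j))"
    using n by simp
  also have "sigma_star 1 0 = 1 / 8"
    by (simp add: sigma_star_def)
  finally show ?thesis
    using inner by simp
qed

end
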